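(* Let $G=(V,E)$ be a countably infinite simple graph. Suppose that for every finite set $A\subseteq V$ of vertices, $G$ has an automorphism $\theta$ such that $\theta(A)\cap A=\varnothing$. Then, for every $p\in[0,1]$, every (measurable) graph-theoretic property of a random subgraph of $G$ with parameter $p$ is deterministic; that is, the probability that the random subgraph satisfies the property is either $0$ or $1$.
   Context: All graphs are simple. A graph-theoretic property $P$ is a property of graphs that is invariant under graph isomorphisms: if $G$ and $H$ are isomorphic graphs, then $G$ satisfies $P$ if and only if $H$ does. A random subgraph of $G=(V,E)$ with parameter $p$ is the random graph with vertex set $V$ obtained from $G$ by removing each edge of $E$ with probability $1-p$ and keeping it with probability $p$, independently of the other edges. Subgraphs of $G$ obtained by removing edges are identified with elements of $\{0,1\}^E$ (with the product $\sigma$-algebra), the value at $e$ indicating whether $e$ is kept; a property $P$, restricted to such subgraphs, is viewed as a subset of $\{0,1\}^E$, and it is assumed that this subset is measurable. *)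

theory Defs
  imports "HOL-Probability.Probability"
begin

text \<open>A graph is a vertex set together with a set of edges, an edge being an unordered pair
  of vertices, represented as a two-element set.\<close>

type_synonym 'v ugraph = "'v set \<times> 'v set set"

abbreviation verts :: "'v ugraph \<Rightarrow> 'v set" where
  "verts G \<equiv> fst G"

abbreviation edges :: "'v ugraph \<Rightarrow> 'v set set" where
  "edges G \<equiv> snd G"

definition simple_graph :: "'v ugraph \<Rightarrow> bool" where
  "simple_graph G \<longleftrightarrow> (\<forall>e\<in>edges G. e \<subseteq> verts G \<and> card e = 2)"

definition graph_isomorphism :: "('v \<Rightarrow> 'w) \<Rightarrow> 'v ugraph \<Rightarrow> 'w ugraph \<Rightarrow> bool" where
  "graph_isomorphism f G H \<longleftrightarrow>
     bij_betw f (verts G) (verts H) \<and>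
     (\<forall>x\<in>verts G. \<forall>y\<in>verts G. {x, y} \<in> edges G \<longleftrightarrow> {f x, f y} \<in> edges H)"

definition isomorphic_graphs :: "'v ugraph \<Rightarrow> 'w ugraph \<Rightarrow> bool" where
  "isomorphic_graphs G H \<longleftrightarrow> (\<exists>f. graph_isomorphism f G H)"

definition graph_automorphism :: "('v \<Rightarrow> 'v) \<Rightarrow> 'v ugraph \<Rightarrow> bool" where
  "graph_automorphism f G \<longleftrightarrow> graph_isomorphism f G G"

text \<open>Every isomorphism-invariant property of arbitrary graphs restricts to the graphs whose
  vertices lie in the type \<^typ>\<open>'v\<close>, and every invariant property of those extends
  to an invariant property of arbitrary graphs, so fixing the vertex type loses nothing.\<close>

definition graph_property :: "('v ugraph \<Rightarrow> bool) \<Rightarrow> bool" where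
  "graph_property P \<longleftrightarrow>
     (\<forall>G H. simple_graph G \<longrightarrow> simple_graph H \<longrightarrow> isomorphic_graphs G H \<longrightarrow> (P G \<longleftrightarrow> P H))"

text \<open>The product space \<open>{0,1}\<^sup>E\<close>, with \<open>True\<close> for a kept edge. Its points are the
  functions that are \<open>undefined\<close> outside \<open>E\<close>; its \<open>\<sigma>\<close>-algebra does not depend on \<open>p\<close>.\<close>

definition edge_percolation :: "'v ugraph \<Rightarrow> real \<Rightarrow> ('v set \<Rightarrow> bool) measure" where
  "edge_percolation G p = (\<Pi>\<^sub>M e\<in>edges G. measure_pmf (bernoulli_pmf p))"

definition kept_subgraph :: "'v ugraph \<Rightarrow> ('v set \<Rightarrow> bool) \<Rightarrow> 'v ugraph" where
  "kept_subgraph G \<omega> = (verts G, {e \<in> edges G. \<omega> e})"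

definition subgraph_event :: "'v ugraph \<Rightarrow> real \<Rightarrow> ('v ugraph \<Rightarrow> bool) \<Rightarrow> ('v set \<Rightarrow> bool) set" where
  "subgraph_event G p P = {\<omega> \<in> space (edge_percolation G p). P (kept_subgraph G \<omega>)}"

end

theory Submission
  imports Defs
begin

text \<open>An event of the product space is approximated, up to \<open>\<epsilon>\<close>, by a cylinder over finitely
  many edges. An automorphism that moves the finite set of their end points off itself transports
  the cylinder to an independent one of the same probability, while it fixes an event given by a
  graph property. Hence the probability \<open>b\<close> of such an event satisfies \<open>\<bar>b - b\<^sup>2\<bar> \<le> 4\<epsilon>\<close> for all
  \<open>\<epsilon>\<close>.\<close>

section \<open>Approximating events by members of a generating algebra\<close>

lemma (in finite_measure) measure_diff_le_sym_diff:
  assumes "A \<in> sets M" "B \<in> sets M"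
  shows "\<bar>measure M A - measure M B\<bar> \<le> measure M (sym_diff A B)"
proof -
  have "measure M X \<le> measure M Y + measure M (sym_diff A B)"
    if "X \<in> sets M" "Y \<in> sets M" "X - Y \<subseteq> sym_diff A B" for X Y
  proof -
    have "measure M X \<le> measure M (Y \<union> sym_diff A B)"
      using that assms by (intro finite_measure_mono) auto
    also have "\<dots> \<le> measure M Y + measure M (sym_diff A B)"
      using that assms by (intro measure_Un_le) auto
    finally show ?thesis .
  qed
  from this[of A B] this[of B A] show ?thesis
    using assms by auto
qed

text \<open>The sets that members of \<open>G\<close> approximate arbitrarily well include
  \<open>G\<close> and are closed under complements and countable unions, so induction over
  \<open>sigma_sets\<close> reaches every event.\<close>

lemma (in finite_measure) sym_diff_algebra_approx:
  assumes alg: "algebra (space M) G" and sets: "sets M = sigma_sets (space M) G"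
    and "B \<in> sets M" "0 < \<epsilon>"
  obtains C where "C \<in> G" "measure M (sym_diff B C) < \<epsilon>"
proof -
  interpret algebra "space M" G by fact
  have G: "C \<in> sets M" if "C \<in> G" for C
    using that by (simp add: sets sigma_sets.Basic)
  define approx where
    "approx B \<longleftrightarrow> B \<in> sets M \<and> (\<forall>\<epsilon>>0. \<exists>C\<in>G. measure M (sym_diff B C) < \<epsilon>)" for B
  have approxD: "\<exists>C\<in>G. measure M (sym_diff B C) < \<epsilon>" if "approx B" "0 < \<epsilon>" for B \<epsilon>
    using that by (auto simp: approx_def)
  have approx_Un: "approx (A \<union> B)" if "approx A" "approx B" for A B
    unfolding approx_def
  proof safe
    fix \<epsilon> :: real assume "0 < \<epsilon>"
    then have "0 < \<epsilon>/2" by simp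
    with that obtain C D where CD: "C \<in> G" "D \<in> G"
      "measure M (sym_diff A C) < \<epsilon>/2" "measure M (sym_diff B D) < \<epsilon>/2"
      by (blast dest: approxD)
    have AB: "A \<in> sets M" "B \<in> sets M" using that by (auto simp: approx_def)
    have "measure M (sym_diff (A \<union> B) (C \<union> D)) \<le> measure M (sym_diff A C \<union> sym_diff B D)"
      using AB G CD by (intro finite_measure_mono) auto
    also have "\<dots> \<le> measure M (sym_diff A C) + measure M (sym_diff B D)"
      using AB G CD by (intro measure_Un_le) auto
    finally show "\<exists>E\<in>G. measure M (sym_diff (A \<union> B) E) < \<epsilon>"
      using CD by (intro bexI[of _ "C \<union> D"]) auto
  qed (use that in \<open>auto simp: approx_def\<close>)
  have "approx B"
    using \<open>B \<in> sets M\<close> unfolding sets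
  proof induction
    case (Basic A)
    then show ?case by (auto simp: approx_def G intro!: bexI[of _ A])
  next
    case Empty
    then show ?case by (auto simp: approx_def intro!: bexI[of _ "{}"])
  next
    case (Compl A)
    show ?case
      unfolding approx_def
    proof safe
      fix \<epsilon> :: real assume "0 < \<epsilon>"
      then obtain C where C: "C \<in> G" "measure M (sym_diff A C) < \<epsilon>"
        using Compl by (auto simp: approx_def)
      \<comment> \<open>Complementing both sets does not change where they differ, so the complement
        of the approximant serves with the same error.\<close>
      have "sym_diff (space M - A) (space M - C) = sym_diff A C"
        using Compl C G[THEN sets.sets_into_space] sets.sets_into_space[of A M]
        by (auto simp: approx_def)
      with C show "\<exists>C\<in>G. measure M (sym_diff (space M - A) C) < \<epsilon>"
        by (intro bexI[of _ "space M - C"]) auto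
    qed (use Compl in \<open>auto simp: approx_def\<close>)
  next
    case (Union A)
    have A: "A i \<in> sets M" for i using Union by (auto simp: approx_def)
    \<comment> \<open>An algebra is closed only under finite unions, so the union is truncated
      first. Continuity from below makes the lost tail smaller than \<epsilon>/2; approximating
      \<open>U n\<close> by a member of \<open>G\<close> costs another \<epsilon>/2.\<close>
    define U where "U n = (\<Union>i\<le>n. A i)" for n :: nat
    have U: "U n \<in> sets M" for n using A by (auto simp: U_def)
    have approx_U: "approx (U n)" for n
    proof (induction n)
      case 0
      then show ?case using Union by (simp add: U_def)
    next
      case (Suc n)
      have "U (Suc n) = U n \<union> A (Suc n)" by (auto simp: U_def le_Suc_eq)
      then show ?case using Suc Union approx_Un by auto
    qed
    have lim: "(\<lambda>n. measure M (U n)) \<longlonglongrightarrow> measure M (\<Union>n. U n)"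
      using U by (intro finite_Lim_measure_incseq) (force simp: U_def incseq_def)+
    have UA: "(\<Union>n. U n) = (\<Union>i. A i)" by (auto simp: U_def)
    show ?case
      unfolding approx_def
    proof safe
      fix \<epsilon> :: real assume "0 < \<epsilon>"
      then obtain n where "\<bar>measure M (U n) - measure M (\<Union>i. A i)\<bar> < \<epsilon>/2"
        using LIMSEQ_D[OF lim, of "\<epsilon>/2"] UA by auto
      moreover have "measure M ((\<Union>i. A i) - U n) = measure M (\<Union>i. A i) - measure M (U n)"
        using A U by (intro finite_measure_Diff) (auto simp: U_def)
      moreover obtain C where C: "C \<in> G" "measure M (sym_diff (U n) C) < \<epsilon>/2"
        using approxD[OF approx_U half_gt_zero[OF \<open>0 < \<epsilon>\<close>]] by blast
      moreover have "measure M (sym_diff (\<Union>i. A i) C)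
          \<le> measure M (((\<Union>i. A i) - U n) \<union> sym_diff (U n) C)"
        using A U G C by (intro finite_measure_mono) (auto simp: U_def)
      moreover have "\<dots> \<le> measure M ((\<Union>i. A i) - U n) + measure M (sym_diff (U n) C)"
        using A U G C by (intro measure_Un_le) auto
      ultimately have "measure M (sym_diff (\<Union>i. A i) C) < \<epsilon>"
        by linarith
      with \<open>C \<in> G\<close> show "\<exists>C\<in>G. measure M (sym_diff (\<Union>i. A i) C) < \<epsilon>"
        by blast
    qed (use A in auto)
  qed
  with \<open>0 < \<epsilon>\<close> that show ?thesis by (auto simp: approx_def)
qed

section \<open>Independence, reindexing and a zero-one law on product spaces\<close>

context product_prob_space
begin

text \<open>Restriction to \<open>I\<close> fixes the extensional points of the product, so the
  joint law of the coordinates is \<open>PiM I M\<close>, the product of their marginal laws. This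
  criterion is for nonempty \<open>I\<close>; the empty family is independent by definition.\<close>

lemma indep_vars_coordinates: "indep_vars M (\<lambda>i \<omega>. \<omega> i) I"
proof (cases "I = {}")
  case True
  then show ?thesis unfolding indep_vars_def indep_sets_def by auto
next
  case False
  have "distr (PiM I M) (PiM I M) (\<lambda>\<omega>. \<lambda>i\<in>I. \<omega> i) = distr (PiM I M) (PiM I M) (\<lambda>\<omega>. \<omega>)"
    by (intro distr_cong) (auto simp: space_PiM)
  also have "\<dots> = PiM I (\<lambda>i. distr (PiM I M) (M i) (\<lambda>\<omega>. \<omega> i))"
    by (simp add: PiM_component cong: PiM_cong)
  finally show ?thesis
    using False by (subst indep_vars_iff_distr_eq_PiM') auto
qed

text \<open>The cylinders are preimages under the restrictions to \<open>J\<close> and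
  \<open>K\<close>, which are independent because they read disjoint blocks of independent
  coordinates.\<close>

lemma prob_Int_emb_disjoint:
  assumes "J \<subseteq> I" "K \<subseteq> I" "J \<inter> K = {}" "X \<in> sets (PiM J M)" "Y \<in> sets (PiM K M)"
  shows "prob (emb I J X \<inter> emb I K Y) = prob (emb I J X) * prob (emb I K Y)"
proof -
  have "indep_var (PiM J M) (\<lambda>\<omega>. restrict \<omega> J) (PiM K M) (\<lambda>\<omega>. restrict \<omega> K)"
    using indep_var_restrict[OF indep_vars_coordinates] assms by simp
  moreover have "emb I L Z = (\<lambda>\<omega>. restrict \<omega> L) -` Z \<inter> space (PiM I M)" for L Z
    by (simp add: prod_emb_def space_PiM)
  moreover have "emb I J X \<inter> emb I K Y =
      (\<lambda>\<omega>. (restrict \<omega> J, restrict \<omega> K)) -` (X \<times> Y) \<inter> space (PiM I M)"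
    by (auto simp: prod_emb_def space_PiM)
  ultimately show ?thesis
    using assms by (simp add: indep_varD)
qed

text \<open>Injectivity of \<phi> makes the coordinates read at different \<open>i\<close> distinct,
  hence independent, and each has the law \<open>M i\<close>. So reindexing preserves the product
  measure.\<close>

lemma prob_reindex:
  assumes \<phi>: "inj_on \<phi> I" "\<phi> \<in> I \<rightarrow> I" "\<And>i. i \<in> I \<Longrightarrow> M (\<phi> i) = M i"
    and "A \<in> events"
  shows "prob ((\<lambda>\<omega>. \<lambda>i\<in>I. \<omega> (\<phi> i)) -` A \<inter> space (PiM I M)) = prob A"
    and "(\<lambda>\<omega>. \<lambda>i\<in>I. \<omega> (\<phi> i)) -` A \<inter> space (PiM I M) \<in> events"
proof -
  have eq: "PiM I (\<lambda>i. M (\<phi> i)) = PiM I M"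
    using \<phi> by (intro PiM_cong) auto
  have meas: "(\<lambda>\<omega>. \<lambda>i\<in>I. \<omega> (\<phi> i)) \<in> measurable (PiM I M) (PiM I M)"
  proof (intro measurable_restrict)
    show "(\<lambda>\<omega>. \<omega> (\<phi> i)) \<in> measurable (PiM I M) (M i)" if "i \<in> I" for i
      using measurable_component_singleton[of "\<phi> i" I M] \<phi> that by auto
  qed
  then show "(\<lambda>\<omega>. \<lambda>i\<in>I. \<omega> (\<phi> i)) -` A \<inter> space (PiM I M) \<in> events"
    using \<open>A \<in> events\<close> by (rule measurable_sets)
  have "prob A = measure (distr (PiM I M) (PiM I M) (\<lambda>\<omega>. \<lambda>i\<in>I. \<omega> (\<phi> i))) A"
    using distr_PiM_reindex[of I M \<phi> I] \<phi> M.prob_space_axioms eq by simp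
  then show "prob ((\<lambda>\<omega>. \<lambda>i\<in>I. \<omega> (\<phi> i)) -` A \<inter> space (PiM I M)) = prob A"
    using meas assms by (simp add: measure_distr)
qed

text \<open>The zero-one argument freed from graphs: edges become indices and automorphisms become
  index maps \<phi>. The map may depend on \<open>J\<close>, but each one must leave
  \<open>B\<close> invariant.\<close>

lemma zero_one_law_reindex:
  assumes B: "B \<in> events"
    and shift: "\<And>J. finite J \<Longrightarrow> J \<subseteq> I \<Longrightarrow>
      \<exists>\<phi>. inj_on \<phi> I \<and> \<phi> \<in> I \<rightarrow> I \<and> (\<forall>i\<in>I. M (\<phi> i) = M i) \<and> \<phi> ` J \<inter> J = {} \<and>
        (\<forall>\<omega>\<in>space (PiM I M). (\<lambda>i\<in>I. \<omega> (\<phi> i)) \<in> B \<longleftrightarrow> \<omega> \<in> B)"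
  shows "prob B = 0 \<or> prob B = 1"
proof -
  have "\<bar>prob B - (prob B)\<^sup>2\<bar> \<le> \<epsilon>" if "0 < \<epsilon>" for \<epsilon>
  proof -
    \<comment> \<open>With b, c the probabilities of \<open>B\<close>, \<open>C\<close> and \<delta>
      that of their symmetric difference, both \<bar>b - c^2\<bar> and \<bar>b^2 - c^2\<bar> will be
      at most 2\<delta>; hence a quarter of \<epsilon>.\<close>
    have "0 < \<epsilon> / 4" using that by simp
    then obtain C where C: "C \<in> generator" and BC: "prob (sym_diff B C) < \<epsilon> / 4"
      by (rule sym_diff_algebra_approx[OF algebra_generator sets_PiM_generator B])
    then obtain J X where J: "finite J" "J \<subseteq> I" and X: "X \<in> sets (PiM J M)"
      and CX: "C = emb I J X"
      by (auto elim: generator.cases)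
    have C_ev: "C \<in> events"
      using C by (simp add: sets_PiM_generator sigma_sets.Basic)
    obtain \<phi> where \<phi>: "inj_on \<phi> I" "\<phi> \<in> I \<rightarrow> I" "\<And>i. i \<in> I \<Longrightarrow> M (\<phi> i) = M i"
      and disj: "\<phi> ` J \<inter> J = {}"
      and inv: "\<And>\<omega>. \<omega> \<in> space (PiM I M) \<Longrightarrow> (\<lambda>i\<in>I. \<omega> (\<phi> i)) \<in> B \<longleftrightarrow> \<omega> \<in> B"
      using shift[OF J] by metis
    define T where "T A = (\<lambda>\<omega>. \<lambda>i\<in>I. \<omega> (\<phi> i)) -` A \<inter> space (PiM I M)" for A
    have T: "prob (T A) = prob A" "T A \<in> events" if "A \<in> events" for A
      unfolding T_def using prob_reindex[OF \<phi>(1,2) _ that] \<phi>(3) by blast+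
    have TB: "T B = B"
      using inv sets.sets_into_space[OF B] by (auto simp: T_def)
    \<comment> \<open>The base \<open>X\<close> carried over to the coordinates in the image of
      \<open>J\<close>. Since \<phi> moves \<open>J\<close> off itself, \<open>T C\<close> is
      thereby a cylinder over coordinates disjoint from those of \<open>C\<close>.\<close>
    define Y where "Y = (\<lambda>\<eta>. \<lambda>j\<in>J. \<eta> (\<phi> j)) -` X \<inter> space (PiM (\<phi> ` J) M)"
    have "(\<lambda>\<eta>. \<lambda>j\<in>J. \<eta> (\<phi> j)) \<in> measurable (PiM (\<phi> ` J) M) (PiM J (\<lambda>j. M (\<phi> j)))"
      by (auto intro!: measurable_restrict measurable_component_singleton)
    also have "PiM J (\<lambda>j. M (\<phi> j)) = PiM J M"
      using J \<phi> by (intro PiM_cong) auto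
    finally have Y: "Y \<in> sets (PiM (\<phi> ` J) M)"
      using X unfolding Y_def by (rule measurable_sets)
    have "\<omega> \<in> T C \<longleftrightarrow> \<omega> \<in> emb I (\<phi> ` J) Y" if \<omega>: "\<omega> \<in> space (PiM I M)" for \<omega>
    proof -
      have "restrict (\<lambda>i\<in>I. \<omega> (\<phi> i)) J = (\<lambda>j\<in>J. restrict \<omega> (\<phi> ` J) (\<phi> j))"
        using J by (auto simp: fun_eq_iff)
      moreover have "(\<lambda>i\<in>I. \<omega> (\<phi> i)) \<in> (\<Pi>\<^sub>E i\<in>I. space (M i))"
        using \<omega> \<phi> by (force simp: space_PiM PiE_iff)
      moreover have "restrict \<omega> (\<phi> ` J) \<in> space (PiM (\<phi> ` J) M)"
        using \<omega> \<phi> J by (force simp: space_PiM PiE_iff)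
      ultimately show ?thesis
        using \<omega> by (simp add: T_def CX Y_def prod_emb_def space_PiM)
    qed
    then have "T C = emb I (\<phi> ` J) Y"
      using prod_emb_subset_PiM by (fastforce simp: T_def)
    then have indep: "prob (C \<inter> T C) = (prob C)\<^sup>2"
      using prob_Int_emb_disjoint[of J "\<phi> ` J" X Y] J \<phi> disj X Y T(1)[OF C_ev]
      by (auto simp: CX power2_eq_square Int_commute)
    \<comment> \<open>Taking preimages commutes with set operations and \<open>T\<close> fixes
      \<open>B\<close>, so \<open>T C\<close> approximates \<open>B\<close> exactly as well as
      \<open>C\<close> does, and the intersection of the two does so with at most twice the
      error.\<close>
    have "sym_diff B (T C) = T (sym_diff B C)"
      using TB by (auto simp: T_def)
    then have "prob (sym_diff B (T C)) = prob (sym_diff B C)"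
      using T(1)[of "sym_diff B C"] B C_ev by auto
    moreover have "prob (sym_diff B (C \<inter> T C)) \<le> prob (sym_diff B C \<union> sym_diff B (T C))"
      using B C_ev T(2) by (intro finite_measure_mono) auto
    moreover have "\<dots> \<le> prob (sym_diff B C) + prob (sym_diff B (T C))"
      using B C_ev T(2) by (intro measure_Un_le) auto
    moreover have "\<bar>prob B - (prob C)\<^sup>2\<bar> \<le> prob (sym_diff B (C \<inter> T C))"
      using measure_diff_le_sym_diff[of B "C \<inter> T C"] B C_ev T(2) indep by auto
    moreover have "\<bar>(prob B)\<^sup>2 - (prob C)\<^sup>2\<bar> \<le> 2 * prob (sym_diff B C)"
    proof -
      have "\<bar>(prob B)\<^sup>2 - (prob C)\<^sup>2\<bar> = (prob B + prob C) * \<bar>prob B - prob C\<bar>"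
        by (simp add: power2_eq_square square_diff_square_factored abs_mult)
      also have "\<dots> \<le> 2 * prob (sym_diff B C)"
        using add_mono[OF prob_le_1[of B] prob_le_1[of C]]
        by (intro mult_mono measure_diff_le_sym_diff B C_ev) auto
      finally show ?thesis .
    qed
    ultimately show ?thesis using BC by linarith
  qed
  then have "\<bar>prob B - (prob B)\<^sup>2\<bar> \<le> 0"
    by - (rule field_le_epsilon, simp)
  then show ?thesis
    by (simp add: power2_eq_square)
qed

end

section \<open>Automorphisms acting on edges and on percolation configurations\<close>

lemma graph_automorphism_edge_image:
  assumes "graph_automorphism \<theta> G" "e \<subseteq> verts G" "card e = 2"
  shows "\<theta> ` e \<in> edges G \<longleftrightarrow> e \<in> edges G"
proof -
  obtain x y where "e = {x, y}" using \<open>card e = 2\<close> by (auto simp: card_2_iff)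
  with assms show ?thesis
    by (simp add: graph_automorphism_def graph_isomorphism_def)
qed

lemma simple_graph_kept_subgraph: "simple_graph G \<Longrightarrow> simple_graph (kept_subgraph G \<omega>)"
  by (auto simp: simple_graph_def kept_subgraph_def)

text \<open>The pulled-back configuration keeps an edge exactly when \<omega> keeps its image, so
  \<theta> itself is the isomorphism. Hence no graph property can distinguish the two
  subgraphs.\<close>

lemma kept_subgraph_automorphism:
  assumes "graph_automorphism \<theta> G"
  shows "isomorphic_graphs (kept_subgraph G (\<lambda>e\<in>edges G. \<omega> (\<theta> ` e))) (kept_subgraph G \<omega>)"
  unfolding isomorphic_graphs_def graph_isomorphism_def
proof (intro exI[of _ \<theta>] conjI ballI)
  show "bij_betw \<theta> (verts (kept_subgraph G (\<lambda>e\<in>edges G. \<omega> (\<theta> ` e)))) (verts (kept_subgraph G \<omega>))"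
    using assms by (simp add: kept_subgraph_def graph_automorphism_def graph_isomorphism_def)
next
  fix x y
  assume "x \<in> verts (kept_subgraph G (\<lambda>e\<in>edges G. \<omega> (\<theta> ` e)))"
    "y \<in> verts (kept_subgraph G (\<lambda>e\<in>edges G. \<omega> (\<theta> ` e)))"
  then have "{x, y} \<in> edges G \<longleftrightarrow> {\<theta> x, \<theta> y} \<in> edges G"
    using assms by (simp add: kept_subgraph_def graph_automorphism_def graph_isomorphism_def)
  \<comment> \<open>Outside \<open>edges G\<close> the pulled-back configuration is
    \<open>undefined\<close>, but \<open>kept_subgraph\<close> consults it only on edges of
    \<open>G\<close>.\<close>
  then show "{x, y} \<in> edges (kept_subgraph G (\<lambda>e\<in>edges G. \<omega> (\<theta> ` e))) \<longleftrightarrow>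
      {\<theta> x, \<theta> y} \<in> edges (kept_subgraph G \<omega>)"
    by (simp add: kept_subgraph_def)
qed

theorem corollary1p1:
  fixes G :: "'v ugraph" and p :: real and P :: "'v ugraph \<Rightarrow> bool"
  assumes "simple_graph G"
    and "countable (verts G)" and "infinite (verts G)"
    and "\<And>A. A \<subseteq> verts G \<Longrightarrow> finite A \<Longrightarrow>
           \<exists>\<theta>. graph_automorphism \<theta> G \<and> \<theta> ` A \<inter> A = {}"
    and "0 \<le> p" and "p \<le> 1"
    and "graph_property P"
    and "subgraph_event G p P \<in> sets (edge_percolation G p)"
  shows "measure (edge_percolation G p) (subgraph_event G p P) = 0 \<or>
         measure (edge_percolation G p) (subgraph_event G p P) = 1"
proof -
  interpret product_prob_space "\<lambda>_. measure_pmf (bernoulli_pmf p)" "edges G"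
    by unfold_locales
  have edge: "e \<subseteq> verts G" "card e = 2" if "e \<in> edges G" for e
    using assms(1) that by (auto simp: simple_graph_def)
  \<comment> \<open>The index map will be the action of \<theta> on edges, where \<theta> moves the
    finite set of end points of \<open>J\<close> off itself. All edges carry the same Bernoulli
    measure, so the condition on the factors holds at once.\<close>
  have shift: "\<exists>\<phi>. inj_on \<phi> (edges G) \<and> \<phi> \<in> edges G \<rightarrow> edges G \<and> \<phi> ` J \<inter> J = {} \<and>
      (\<forall>\<omega>\<in>space (edge_percolation G p).
        (\<lambda>e\<in>edges G. \<omega> (\<phi> e)) \<in> subgraph_event G p P \<longleftrightarrow> \<omega> \<in> subgraph_event G p P)"
    if J: "finite J" "J \<subseteq> edges G" for J
  proof -
    have "\<Union>J \<subseteq> verts G"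
      using J edge by blast
    moreover have "finite (\<Union>J)"
      using J edge(2) by (intro finite_Union) (auto intro!: card_ge_0_finite)
    ultimately obtain \<theta> where \<theta>: "graph_automorphism \<theta> G" and disj: "\<theta> ` \<Union>J \<inter> \<Union>J = {}"
      using assms(4)[of "\<Union>J"] by auto
    have "inj_on \<theta> (verts G)"
      using \<theta> by (simp add: graph_automorphism_def graph_isomorphism_def bij_betw_def)
    then have "inj_on ((`) \<theta>) (edges G)"
      using edge by (meson inj_onI inj_on_image_eq_iff)
    moreover have "(`) \<theta> \<in> edges G \<rightarrow> edges G"
      using graph_automorphism_edge_image[OF \<theta>] edge by auto
    \<comment> \<open>Disjointness passes from vertices to edges because edges are nonempty: a
      common edge would supply a common vertex.\<close>
    moreover have "(`) \<theta> ` J \<inter> J = {}"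
    proof (rule ccontr)
      assume "(`) \<theta> ` J \<inter> J \<noteq> {}"
      then obtain e where e: "e \<in> J" "\<theta> ` e \<in> J" by auto
      then have "card e = 2" using J edge(2) by auto
      then obtain x where "x \<in> e" by (auto simp: card_2_iff)
      with e have "\<theta> x \<in> \<theta> ` \<Union>J \<inter> \<Union>J" by blast
      with disj show False by simp
    qed
    moreover have "(\<lambda>e\<in>edges G. \<omega> (\<theta> ` e)) \<in> subgraph_event G p P \<longleftrightarrow>
        \<omega> \<in> subgraph_event G p P" if "\<omega> \<in> space (edge_percolation G p)" for \<omega>
    proof -
      have "P (kept_subgraph G (\<lambda>e\<in>edges G. \<omega> (\<theta> ` e))) \<longleftrightarrow> P (kept_subgraph G \<omega>)"
        using assms(7) simple_graph_kept_subgraph[OF assms(1)] kept_subgraph_automorphism[OF \<theta>]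
        unfolding graph_property_def by blast
      with that show ?thesis
        by (simp add: subgraph_event_def edge_percolation_def space_PiM)
    qed
    ultimately show ?thesis
      by (intro exI[of _ "(`) \<theta>"] conjI ballI)
  qed
  show ?thesis
    using zero_one_law_reindex[of "subgraph_event G p P"] shift assms(8)
    unfolding edge_percolation_def by simp
qed

end
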